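(* (i) Any dBa $\textbf{D}$ is quasi-embedded into $\underline{\mathfrak{R}}^{T}(\mathbb{K}_{pr}^{T}(\textbf{D}))$, where $h:D\rightarrow\mathfrak{R}^{T}(\mathbb{K}_{pr}^{T}(\textbf{D}))$ defined by $h(x):=(F_{\neg x}, I_{x})$ for all $x\in D$ gives the required quasi-injective dBa homomorphism. Moreover, $\textbf{D}_{p}$ is isomorphic to $\mathcal{S}^{T}(\mathbb{K}_{pr}^{T}(\textbf{D}))$. (ii) Any contextual dBa $\textbf{D}$ is embedded into $\underline{\mathfrak{R}}^{T}(\mathbb{K}_{pr}^{T}(\textbf{D}))$, the map $h:D\rightarrow\mathfrak{R}^{T}(\mathbb{K}_{pr}^{T}(\textbf{D}))$, $h(x):=(F_{\neg x}, I_{x})$, giving the required injective dBa homomorphism.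
   Context: $\textbf{D}=(D,\sqcup,\sqcap,\neg,\lrcorner,\top,\bot)$ is a double Boolean algebra (dBa) with quasi-order $x\sqsubseteq y$ iff $x\sqcap y=x\sqcap x$ and $x\sqcup y=y\sqcup y$; it is contextual if $\sqsubseteq$ is a partial order. $\textbf{D}_p$ is the subalgebra on $D_p=\{x: x\sqcap x=x\}\cup\{x: x\sqcup x=x\}$. $\mathcal{F}_{pr}(\textbf{D})$, $\mathcal{I}_{pr}(\textbf{D})$ are the sets of primary filters and primary ideals; $F_x=\{F\in\mathcal{F}_{pr}(\textbf{D}):x\in F\}$, $I_x=\{I\in\mathcal{I}_{pr}(\textbf{D}):x\in I\}$. $\mathbb{K}_{pr}^{T}(\textbf{D})=((\mathcal{F}_{pr}(\textbf{D}),\mathcal{T}),(\mathcal{I}_{pr}(\textbf{D}),\mathcal{J}),\nabla)$, where $F\nabla I$ iff $F\cap I=\emptyset$, and $\mathcal{T},\mathcal{J}$ have the sets $F_x$, resp. $I_x$, as subbases of closed sets. For a context $(G,M,R)$, $A^{\blacksquare}=\{m: R^{-1}(m)\subseteq A\}$, $B^{\lozenge}=\{g:R(g)\cap B\neq\emptyset\}$; an object oriented protoconcept is $(A,B)$ with $A^{\blacksquare\lozenge}=B^{\lozenge}$, an object oriented semiconcept is $(A,B)$ with $A^{\blacksquare}=B$ or $B^{\lozenge}=A$. $\underline{\mathfrak{R}}^{T}(\mathbb{K}^{T})$ (resp. $\mathcal{S}^{T}(\mathbb{K}^{T})$) is the dBa of object oriented protoconcepts (resp. semiconcepts) with both components clopen,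 with operations $(A,B)\sqcap(C,D)=(A\cup C,(A\cup C)^{\blacksquare})$, $(A,B)\sqcup(C,D)=((B\cap D)^{\lozenge},B\cap D)$, $\neg(A,B)=(A^c,A^{c\blacksquare})$, $\lrcorner(A,B)=(B^{c\lozenge},B^c)$, $\top=(\emptyset,\emptyset)$, $\bot=(G,M)$. A quasi-injective homomorphism satisfies $x\sqsubseteq y$ iff $h(x)\sqsubseteq h(y)$. *)

theory Defs
  imports "HOL-Analysis.Analysis" "HOL-Algebra.Congruence"
begin

section \<open>Double Boolean algebras\<close>

record 'a dba = "'a partial_object" +
  join :: "'a \<Rightarrow> 'a \<Rightarrow> 'a"  (infixl \<open>\<squnion>\<index>\<close> 65)
  meet :: "'a \<Rightarrow> 'a \<Rightarrow> 'a"  (infixl \<open>\<sqinter>\<index>\<close> 70)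
  neg :: "'a \<Rightarrow> 'a"  (\<open>\<^bold>\<not>\<index> _\<close> [81] 80)
  opp :: "'a \<Rightarrow> 'a"  (\<open>\<^bold>\<rfloor>\<index> _\<close> [81] 80)
  top_elem :: 'a  (\<open>\<top>\<index>\<close>)
  bot_elem :: 'a  (\<open>\<bottom>\<index>\<close>)

definition vee :: "('a, 'b) dba_scheme \<Rightarrow> 'a \<Rightarrow> 'a \<Rightarrow> 'a"  (infixl \<open>\<curlyvee>\<index>\<close> 65)
  where "x \<curlyvee>\<^bsub>D\<^esub> y = \<^bold>\<not>\<^bsub>D\<^esub> (\<^bold>\<not>\<^bsub>D\<^esub> x \<sqinter>\<^bsub>D\<^esub> \<^bold>\<not>\<^bsub>D\<^esub> y)"

definition wedge :: "('a, 'b) dba_scheme \<Rightarrow> 'a \<Rightarrow> 'a \<Rightarrow> 'a"  (infixl \<open>\<curlywedge>\<index>\<close> 70)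
  where "x \<curlywedge>\<^bsub>D\<^esub> y = \<^bold>\<rfloor>\<^bsub>D\<^esub> (\<^bold>\<rfloor>\<^bsub>D\<^esub> x \<squnion>\<^bsub>D\<^esub> \<^bold>\<rfloor>\<^bsub>D\<^esub> y)"

text \<open>Wille's equational axioms.\<close>

locale dba =
  fixes D (structure)
  assumes join_closed: "\<lbrakk>x \<in> carrier D; y \<in> carrier D\<rbrakk> \<Longrightarrow> x \<squnion> y \<in> carrier D"
    and meet_closed: "\<lbrakk>x \<in> carrier D; y \<in> carrier D\<rbrakk> \<Longrightarrow> x \<sqinter> y \<in> carrier D"
    and neg_closed: "x \<in> carrier D \<Longrightarrow> \<^bold>\<not> x \<in> carrier D"
    and opp_closed: "x \<in> carrier D \<Longrightarrow> \<^bold>\<rfloor> x \<in> carrier D"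
    and top_closed: "\<top> \<in> carrier D"
    and bot_closed: "\<bottom> \<in> carrier D"
    and meet_idem_left: "\<lbrakk>x \<in> carrier D; y \<in> carrier D\<rbrakk> \<Longrightarrow> (x \<sqinter> x) \<sqinter> y = x \<sqinter> y"
    and join_idem_left: "\<lbrakk>x \<in> carrier D; y \<in> carrier D\<rbrakk> \<Longrightarrow> (x \<squnion> x) \<squnion> y = x \<squnion> y"
    and meet_comm: "\<lbrakk>x \<in> carrier D; y \<in> carrier D\<rbrakk> \<Longrightarrow> x \<sqinter> y = y \<sqinter> x"
    and join_comm: "\<lbrakk>x \<in> carrier D; y \<in> carrier D\<rbrakk> \<Longrightarrow> x \<squnion> y = y \<squnion> x"
    and meet_assoc: "\<lbrakk>x \<in> carrier D; y \<in> carrier D; z \<in> carrier D\<rbrakk>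
          \<Longrightarrow> x \<sqinter> (y \<sqinter> z) = (x \<sqinter> y) \<sqinter> z"
    and join_assoc: "\<lbrakk>x \<in> carrier D; y \<in> carrier D; z \<in> carrier D\<rbrakk>
          \<Longrightarrow> x \<squnion> (y \<squnion> z) = (x \<squnion> y) \<squnion> z"
    and neg_meet_idem: "x \<in> carrier D \<Longrightarrow> \<^bold>\<not> (x \<sqinter> x) = \<^bold>\<not> x"
    and opp_join_idem: "x \<in> carrier D \<Longrightarrow> \<^bold>\<rfloor> (x \<squnion> x) = \<^bold>\<rfloor> x"
    and meet_join_absorb: "\<lbrakk>x \<in> carrier D; y \<in> carrier D\<rbrakk> \<Longrightarrow> x \<sqinter> (x \<squnion> y) = x \<sqinter> x"
    and join_meet_absorb: "\<lbrakk>x \<in> carrier D; y \<in> carrier D\<rbrakk> \<Longrightarrow> x \<squnion> (x \<sqinter> y) = x \<squnion> x"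
    and meet_vee_distrib: "\<lbrakk>x \<in> carrier D; y \<in> carrier D; z \<in> carrier D\<rbrakk>
          \<Longrightarrow> x \<sqinter> (y \<curlyvee> z) = (x \<sqinter> y) \<curlyvee> (x \<sqinter> z)"
    and join_wedge_distrib: "\<lbrakk>x \<in> carrier D; y \<in> carrier D; z \<in> carrier D\<rbrakk>
          \<Longrightarrow> x \<squnion> (y \<curlywedge> z) = (x \<squnion> y) \<curlywedge> (x \<squnion> z)"
    and meet_vee_absorb: "\<lbrakk>x \<in> carrier D; y \<in> carrier D\<rbrakk> \<Longrightarrow> x \<sqinter> (x \<curlyvee> y) = x \<sqinter> x"
    and join_wedge_absorb: "\<lbrakk>x \<in> carrier D; y \<in> carrier D\<rbrakk> \<Longrightarrow> x \<squnion> (x \<curlywedge> y) = x \<squnion> x"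
    and neg_neg_meet: "\<lbrakk>x \<in> carrier D; y \<in> carrier D\<rbrakk> \<Longrightarrow> \<^bold>\<not> (\<^bold>\<not> (x \<sqinter> y)) = x \<sqinter> y"
    and opp_opp_join: "\<lbrakk>x \<in> carrier D; y \<in> carrier D\<rbrakk> \<Longrightarrow> \<^bold>\<rfloor> (\<^bold>\<rfloor> (x \<squnion> y)) = x \<squnion> y"
    and meet_neg: "x \<in> carrier D \<Longrightarrow> x \<sqinter> \<^bold>\<not> x = \<bottom>"
    and join_opp: "x \<in> carrier D \<Longrightarrow> x \<squnion> \<^bold>\<rfloor> x = \<top>"
    and neg_bot: "\<^bold>\<not> \<bottom> = \<top> \<sqinter> \<top>"
    and opp_top: "\<^bold>\<rfloor> \<top> = \<bottom> \<squnion> \<bottom>"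
    and neg_top: "\<^bold>\<not> \<top> = \<bottom>"
    and opp_bot: "\<^bold>\<rfloor> \<bottom> = \<top>"
    and meet_join_idem: "x \<in> carrier D
          \<Longrightarrow> (x \<sqinter> x) \<squnion> (x \<sqinter> x) = (x \<squnion> x) \<sqinter> (x \<squnion> x)"

definition dba_le :: "('a, 'b) dba_scheme \<Rightarrow> 'a \<Rightarrow> 'a \<Rightarrow> bool"  (infix \<open>\<sqsubseteq>\<index>\<close> 50)
  where "x \<sqsubseteq>\<^bsub>D\<^esub> y \<longleftrightarrow> x \<sqinter>\<^bsub>D\<^esub> y = x \<sqinter>\<^bsub>D\<^esub> x \<and> x \<squnion>\<^bsub>D\<^esub> y = y \<squnion>\<^bsub>D\<^esub> y"

definition contextual :: "('a, 'b) dba_scheme \<Rightarrow> bool"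
  where "contextual D \<longleftrightarrow>
    partial_order_on (carrier D) {(x, y) \<in> carrier D \<times> carrier D. x \<sqsubseteq>\<^bsub>D\<^esub> y}"

definition pure_part :: "('a, 'b) dba_scheme \<Rightarrow> ('a, 'b) dba_scheme"
  where "pure_part D = D\<lparr>carrier :=
    {x \<in> carrier D. x \<sqinter>\<^bsub>D\<^esub> x = x} \<union> {x \<in> carrier D. x \<squnion>\<^bsub>D\<^esub> x = x}\<rparr>"

definition dba_hom :: "('a, 'c) dba_scheme \<Rightarrow> ('b, 'd) dba_scheme \<Rightarrow> ('a \<Rightarrow> 'b) \<Rightarrow> bool"
  where "dba_hom D E h \<longleftrightarrow> dba D \<and> dba E \<and> h \<in> carrier D \<rightarrow> carrier E \<and>
    (\<forall>x\<in>carrier D. \<forall>y\<in>carrier D. h (x \<squnion>\<^bsub>D\<^esub> y) = h x \<squnion>\<^bsub>E\<^esub> h y) \<and>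
    (\<forall>x\<in>carrier D. \<forall>y\<in>carrier D. h (x \<sqinter>\<^bsub>D\<^esub> y) = h x \<sqinter>\<^bsub>E\<^esub> h y) \<and>
    (\<forall>x\<in>carrier D. h (\<^bold>\<not>\<^bsub>D\<^esub> x) = \<^bold>\<not>\<^bsub>E\<^esub> (h x)) \<and>
    (\<forall>x\<in>carrier D. h (\<^bold>\<rfloor>\<^bsub>D\<^esub> x) = \<^bold>\<rfloor>\<^bsub>E\<^esub> (h x)) \<and>
    h \<top>\<^bsub>D\<^esub> = \<top>\<^bsub>E\<^esub> \<and> h \<bottom>\<^bsub>D\<^esub> = \<bottom>\<^bsub>E\<^esub>"

definition quasi_embedding :: "('a, 'c) dba_scheme \<Rightarrow> ('b, 'd) dba_scheme \<Rightarrow> ('a \<Rightarrow> 'b) \<Rightarrow> bool"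
  where "quasi_embedding D E h \<longleftrightarrow> dba_hom D E h \<and>
    (\<forall>x\<in>carrier D. \<forall>y\<in>carrier D. x \<sqsubseteq>\<^bsub>D\<^esub> y \<longleftrightarrow> h x \<sqsubseteq>\<^bsub>E\<^esub> h y)"

definition dba_embedding :: "('a, 'c) dba_scheme \<Rightarrow> ('b, 'd) dba_scheme \<Rightarrow> ('a \<Rightarrow> 'b) \<Rightarrow> bool"
  where "dba_embedding D E h \<longleftrightarrow> dba_hom D E h \<and> inj_on h (carrier D)"

definition dba_isomorphic :: "('a, 'c) dba_scheme \<Rightarrow> ('b, 'd) dba_scheme \<Rightarrow> bool"
  where "dba_isomorphic D E \<longleftrightarrow> (\<exists>g. dba_hom D E g \<and> bij_betw g (carrier D) (carrier E))"


section \<open>Primary filters and ideals\<close>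

definition dba_filter :: "('a, 'b) dba_scheme \<Rightarrow> 'a set \<Rightarrow> bool"
  where "dba_filter D F \<longleftrightarrow> F \<subseteq> carrier D \<and>
    (\<forall>x\<in>F. \<forall>y\<in>F. x \<sqinter>\<^bsub>D\<^esub> y \<in> F) \<and>
    (\<forall>x\<in>F. \<forall>z\<in>carrier D. x \<sqsubseteq>\<^bsub>D\<^esub> z \<longrightarrow> z \<in> F)"

definition dba_ideal :: "('a, 'b) dba_scheme \<Rightarrow> 'a set \<Rightarrow> bool"
  where "dba_ideal D I \<longleftrightarrow> I \<subseteq> carrier D \<and>
    (\<forall>x\<in>I. \<forall>y\<in>I. x \<squnion>\<^bsub>D\<^esub> y \<in> I) \<and>
    (\<forall>x\<in>I. \<forall>z\<in>carrier D. z \<sqsubseteq>\<^bsub>D\<^esub> x \<longrightarrow> z \<in> I)"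

definition primary_filters :: "('a, 'b) dba_scheme \<Rightarrow> 'a set set"
  where "primary_filters D = {F. dba_filter D F \<and> F \<noteq> carrier D \<and>
    (\<forall>x\<in>carrier D. x \<in> F \<or> \<^bold>\<not>\<^bsub>D\<^esub> x \<in> F)}"

definition primary_ideals :: "('a, 'b) dba_scheme \<Rightarrow> 'a set set"
  where "primary_ideals D = {I. dba_ideal D I \<and> I \<noteq> carrier D \<and>
    (\<forall>x\<in>carrier D. x \<in> I \<or> \<^bold>\<rfloor>\<^bsub>D\<^esub> x \<in> I)}"

definition filters_at :: "('a, 'b) dba_scheme \<Rightarrow> 'a \<Rightarrow> 'a set set"
  where "filters_at D x = {F \<in> primary_filters D. x \<in> F}"

definition ideals_at :: "('a, 'b) dba_scheme \<Rightarrow> 'a \<Rightarrow> 'a set set"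
  where "ideals_at D x = {I \<in> primary_ideals D. x \<in> I}"


section \<open>Contexts on topological spaces\<close>

text \<open>The object set \<open>G\<close> and the attribute set \<open>M\<close> of a context are the underlying sets
  (\<open>topspace\<close>) of its two topologies.\<close>

record ('g, 'm) top_context =
  objects :: "'g topology"
  attributes :: "'m topology"
  incidence :: "'g \<Rightarrow> 'm \<Rightarrow> bool"

definition oo_box :: "('g, 'm, 'z) top_context_scheme \<Rightarrow> 'g set \<Rightarrow> 'm set"
  where "oo_box K A =
    {m \<in> topspace (attributes K). {g \<in> topspace (objects K). incidence K g m} \<subseteq> A}"

definition oo_diamond :: "('g, 'm, 'z) top_context_scheme \<Rightarrow> 'm set \<Rightarrow> 'g set"
  where "oo_diamond K B =
    {g \<in> topspace (objects K). {m \<in> topspace (attributes K). incidence K g m} \<inter> B \<noteq> {}}"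

definition oo_protoconcepts :: "('g, 'm, 'z) top_context_scheme \<Rightarrow> ('g set \<times> 'm set) set"
  where "oo_protoconcepts K = {(A, B).
    A \<subseteq> topspace (objects K) \<and> B \<subseteq> topspace (attributes K) \<and>
    oo_diamond K (oo_box K A) = oo_diamond K B}"

definition oo_semiconcepts :: "('g, 'm, 'z) top_context_scheme \<Rightarrow> ('g set \<times> 'm set) set"
  where "oo_semiconcepts K = {(A, B).
    A \<subseteq> topspace (objects K) \<and> B \<subseteq> topspace (attributes K) \<and>
    (oo_box K A = B \<or> oo_diamond K B = A)}"

definition clopenin :: "'g topology \<Rightarrow> 'g set \<Rightarrow> bool"
  where "clopenin X A \<longleftrightarrow> closedin X A \<and> openin X A"

definition clopen_pairs :: "('g, 'm, 'z) top_context_scheme \<Rightarrow> ('g set \<times> 'm set) set"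
  where "clopen_pairs K = {(A, B). clopenin (objects K) A \<and> clopenin (attributes K) B}"

definition oo_algebra ::
    "('g, 'm, 'z) top_context_scheme \<Rightarrow> ('g set \<times> 'm set) set \<Rightarrow> ('g set \<times> 'm set) dba"
  where "oo_algebra K P =
    \<lparr>carrier = P,
     join = (\<lambda>(A, B) (C, D). (oo_diamond K (B \<inter> D), B \<inter> D)),
     meet = (\<lambda>(A, B) (C, D). (A \<union> C, oo_box K (A \<union> C))),
     neg = (\<lambda>(A, B). (topspace (objects K) - A, oo_box K (topspace (objects K) - A))),
     opp = (\<lambda>(A, B). (oo_diamond K (topspace (attributes K) - B), topspace (attributes K) - B)),
     top_elem = ({}, {}),
     bot_elem = (topspace (objects K), topspace (attributes K))\<rparr>"

definition clopen_protoconcept_algebra ::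
    "('g, 'm, 'z) top_context_scheme \<Rightarrow> ('g set \<times> 'm set) dba"
  where "clopen_protoconcept_algebra K = oo_algebra K (oo_protoconcepts K \<inter> clopen_pairs K)"

definition clopen_semiconcept_algebra ::
    "('g, 'm, 'z) top_context_scheme \<Rightarrow> ('g set \<times> 'm set) dba"
  where "clopen_semiconcept_algebra K = oo_algebra K (oo_semiconcepts K \<inter> clopen_pairs K)"

definition closed_subbase_topology :: "'g set \<Rightarrow> 'g set set \<Rightarrow> 'g topology"
  where "closed_subbase_topology X \<C> =
    topology (arbitrary union_of (finite intersection_of (\<lambda>U. \<exists>C\<in>\<C>. U = X - C) relative_to X))"

definition primary_context :: "('a, 'b) dba_scheme \<Rightarrow> ('a set, 'a set) top_context"
  where "primary_context D =
    \<lparr>objects = closed_subbase_topology (primary_filters D) (filters_at D ` carrier D),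
     attributes = closed_subbase_topology (primary_ideals D) (ideals_at D ` carrier D),
     incidence = (\<lambda>F I. F \<inter> I = {})\<rparr>"

end

theory Submission
  imports Defs
begin

text \<open>Everything rests on one separation principle. Modulo \<open>x \<sqinter> y = x \<sqinter> x\<close> a dBa is a Boolean
  algebra, so an element outside a set \<open>J\<close> that behaves like a Boolean ideal lies in a primary
  filter avoiding \<open>J\<close>. With \<open>J = {\<bottom>}\<close> this recovers \<open>\<sqsubseteq>\<close> from the sets \<open>F\<^sub>x\<close> and \<open>I\<^sub>x\<close>; with \<open>J\<close> a
  primary ideal it shows that the box operator maps \<open>F\<^bsub>\<not>x\<^esub>\<close> to \<open>I\<^bsub>x\<sqinter>x\<^esub>\<close>; with \<open>J\<close> the set of those
  \<open>z\<close> for which \<open>F\<^sub>z\<close> has a finite subcover it gives compactness, hence every clopen set is some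
  \<open>F\<^sub>x\<close>. Statements about ideals are statements about filters of the dual dBa.\<close>

section \<open>Duality\<close>

definition dba_dual :: "('a, 'b) dba_scheme \<Rightarrow> 'a dba"
  where "dba_dual D = \<lparr>carrier = carrier D, join = meet D, meet = join D, neg = opp D, opp = neg D,
    top_elem = bot_elem D, bot_elem = top_elem D\<rparr>"

lemma dba_dual_simps [simp]:
  "carrier (dba_dual D) = carrier D" "join (dba_dual D) = meet D" "meet (dba_dual D) = join D"
  "neg (dba_dual D) = opp D" "opp (dba_dual D) = neg D"
  "top_elem (dba_dual D) = bot_elem D" "bot_elem (dba_dual D) = top_elem D"
  by (simp_all add: dba_dual_def)

lemma vee_dual [simp]: "vee (dba_dual D) = wedge D"
  by (intro ext) (simp add: vee_def wedge_def)

lemma wedge_dual [simp]: "wedge (dba_dual D) = vee D"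
  by (intro ext) (simp add: vee_def wedge_def)

context dba
begin

text \<open>The axioms come in pairs exchanged by the swap. Only \<open>meet_join_idem\<close> is
  its own partner, and the swap turns its two sides around, hence
  \<open>[symmetric]\<close>.\<close>

lemma dba_dual: "dba (dba_dual D)"
  apply unfold_locales
  unfolding dba_dual_simps vee_dual wedge_dual
  by (rule join_closed meet_closed neg_closed opp_closed top_closed bot_closed
      meet_idem_left join_idem_left meet_comm join_comm meet_assoc join_assoc
      neg_meet_idem opp_join_idem meet_join_absorb join_meet_absorb
      meet_vee_distrib join_wedge_distrib meet_vee_absorb join_wedge_absorb
      neg_neg_meet opp_opp_join meet_neg join_opp neg_bot opp_top neg_top opp_bot
      meet_join_idem [symmetric]; assumption)+

lemma dba_le_dual: "\<lbrakk>x \<in> carrier D; y \<in> carrier D\<rbrakk> \<Longrightarrow> x \<sqsubseteq>\<^bsub>dba_dual D\<^esub> y \<longleftrightarrow> y \<sqsubseteq> x"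
  unfolding dba_le_def by (auto simp: meet_comm join_comm)

lemma primary_filters_dual: "primary_filters (dba_dual D) = primary_ideals D"
proof -
  have "(\<forall>x\<in>I. \<forall>z\<in>carrier D. x \<sqsubseteq>\<^bsub>dba_dual D\<^esub> z \<longrightarrow> z \<in> I)
      \<longleftrightarrow> (\<forall>x\<in>I. \<forall>z\<in>carrier D. z \<sqsubseteq> x \<longrightarrow> z \<in> I)" if "I \<subseteq> carrier D" for I
    using that dba_le_dual by (meson subsetD)
  then have "dba_filter (dba_dual D) I \<longleftrightarrow> dba_ideal D I" for I
    unfolding dba_filter_def dba_ideal_def dba_dual_simps by blast
  then show ?thesis
    unfolding primary_filters_def primary_ideals_def by simp
qed

lemma primary_ideals_dual: "primary_ideals (dba_dual D) = primary_filters D"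
proof -
  have "(\<forall>x\<in>F. \<forall>z\<in>carrier D. z \<sqsubseteq>\<^bsub>dba_dual D\<^esub> x \<longrightarrow> z \<in> F)
      \<longleftrightarrow> (\<forall>x\<in>F. \<forall>z\<in>carrier D. x \<sqsubseteq> z \<longrightarrow> z \<in> F)" if "F \<subseteq> carrier D" for F
    using that dba_le_dual by (meson subsetD)
  then have "dba_ideal (dba_dual D) F \<longleftrightarrow> dba_filter D F" for F
    unfolding dba_filter_def dba_ideal_def dba_dual_simps by blast
  then show ?thesis
    unfolding primary_filters_def primary_ideals_def by simp
qed

lemma filters_at_dual: "filters_at (dba_dual D) = ideals_at D"
  by (intro ext) (simp add: filters_at_def ideals_at_def primary_filters_dual)


section \<open>The preorder induced by the meet\<close>

lemma meet_idem_right: "\<lbrakk>x \<in> carrier D; y \<in> carrier D\<rbrakk> \<Longrightarrow> x \<sqinter> (y \<sqinter> y) = x \<sqinter> y"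
  by (metis meet_closed meet_comm meet_idem_left)

lemma meet_meet_idem: "\<lbrakk>x \<in> carrier D; y \<in> carrier D\<rbrakk> \<Longrightarrow> (x \<sqinter> y) \<sqinter> (x \<sqinter> y) = x \<sqinter> y"
  by (metis meet_assoc meet_closed meet_comm meet_idem_left)

text \<open>Expand \<bottom> as \<open>z\<close> \<sqinter> \<not>\<open>z\<close>; the additional
  factor \<open>z\<close> is then absorbed.\<close>

lemma bot_meet:
  assumes "z \<in> carrier D"
  shows "\<bottom> \<sqinter> z = \<bottom>"
  by (metis assms meet_assoc meet_comm meet_idem_left meet_neg neg_closed)

text \<open>Writing \<top> as the join of \<open>x\<close> with its opposition makes this an
  instance of absorption.\<close>

lemma meet_top: "x \<in> carrier D \<Longrightarrow> x \<sqinter> \<top> = x \<sqinter> x"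
  by (metis join_opp meet_join_absorb opp_closed)

lemma neg_idem: "x \<in> carrier D \<Longrightarrow> \<^bold>\<not> x \<sqinter> \<^bold>\<not> x = \<^bold>\<not> x"
  by (metis neg_closed neg_meet_idem neg_neg_meet)

lemma vee_closed: "\<lbrakk>x \<in> carrier D; y \<in> carrier D\<rbrakk> \<Longrightarrow> x \<curlyvee> y \<in> carrier D"
  by (simp add: vee_def neg_closed meet_closed)

lemma bot_vee_bot: "\<bottom> \<curlyvee> \<bottom> = \<bottom>"
  by (metis bot_closed neg_bot neg_idem neg_meet_idem neg_top top_closed vee_def)

text \<open>Excluded middle relative to \<open>k\<close>. Distributivity pulls \<open>k\<close> out,
  and \<open>x\<close> \<curlyvee> \<not>\<open>x\<close> is \<top> \<sqinter> \<top>, a unit for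
  \<sqinter> up to idempotence.\<close>

lemma meet_vee_neg:
  assumes "k \<in> carrier D" "x \<in> carrier D"
  shows "(k \<sqinter> x) \<curlyvee> (k \<sqinter> \<^bold>\<not> x) = k \<sqinter> k"
proof -
  have "(k \<sqinter> x) \<curlyvee> (k \<sqinter> \<^bold>\<not> x) = k \<sqinter> (x \<curlyvee> \<^bold>\<not> x)"
    using assms by (simp add: meet_vee_distrib neg_closed)
  also have "x \<curlyvee> \<^bold>\<not> x = \<top> \<sqinter> \<top>"
    using assms by (simp add: vee_def neg_closed meet_neg neg_bot)
  also have "k \<sqinter> (\<top> \<sqinter> \<top>) = k \<sqinter> k"
    using assms meet_idem_right [OF _ top_closed] meet_top by metis
  finally show ?thesis .
qed

lemma vee_bot: "\<lbrakk>x \<in> carrier D; y \<in> carrier D\<rbrakk> \<Longrightarrow> (x \<sqinter> y) \<curlyvee> \<bottom> = x \<sqinter> y"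
  by (metis meet_closed meet_meet_idem meet_neg meet_vee_neg)

text \<open>The Boolean join lies below the dBa join. Ideals are closed under \<squnion> only by
  definition; through this lemma they are closed under \<curlyvee> as well.\<close>

lemma vee_meet_join:
  assumes "x \<in> carrier D" "y \<in> carrier D"
  shows "(x \<curlyvee> y) \<sqinter> (x \<squnion> y) = x \<curlyvee> y"
proof -
  let ?w = "x \<squnion> y"
  have "(x \<curlyvee> y) \<sqinter> ?w = ?w \<sqinter> (x \<curlyvee> y)"
    using assms by (simp add: meet_comm vee_closed join_closed)
  also have "\<dots> = (?w \<sqinter> x) \<curlyvee> (?w \<sqinter> y)"
    using assms by (simp add: meet_vee_distrib join_closed)
  also have "?w \<sqinter> x = x \<sqinter> x"
    using assms by (metis join_closed meet_comm meet_join_absorb)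
  also have "?w \<sqinter> y = y \<sqinter> y"
    using assms by (metis join_closed join_comm meet_comm meet_join_absorb)
  finally show ?thesis
    using assms by (simp add: vee_def neg_meet_idem)
qed

text \<open>One half of \<sqsubseteq>, namely the preorder for which a dBa is Boolean. Filters turn
  out to be upward closed for it alone (\<open>filter_meet_le\<close>).\<close>

abbreviation meet_le :: "'a \<Rightarrow> 'a \<Rightarrow> bool"
  where "meet_le x y \<equiv> x \<sqinter> y = x \<sqinter> x"

lemma meet_le_trans:
  assumes "meet_le x y" "meet_le y z" "x \<in> carrier D" "y \<in> carrier D" "z \<in> carrier D"
  shows "meet_le x z"
proof -
  have "x \<sqinter> z = (x \<sqinter> y) \<sqinter> z"
    using assms by (simp add: meet_idem_left)
  also have "\<dots> = x \<sqinter> (y \<sqinter> y)"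
    using assms meet_assoc by metis
  finally show ?thesis
    using assms by (simp add: meet_idem_right)
qed

lemma meet_le_meet:
  assumes "meet_le z x" "meet_le z y" "x \<in> carrier D" "y \<in> carrier D" "z \<in> carrier D"
  shows "meet_le z (x \<sqinter> y)"
  using assms by (simp add: meet_assoc meet_idem_left)

lemma meet_le_left: "\<lbrakk>x \<in> carrier D; y \<in> carrier D\<rbrakk> \<Longrightarrow> meet_le (x \<sqinter> y) x"
  by (metis meet_assoc meet_closed meet_comm meet_idem_left)

lemma meet_le_right: "\<lbrakk>x \<in> carrier D; y \<in> carrier D\<rbrakk> \<Longrightarrow> meet_le (x \<sqinter> y) y"
  by (metis meet_comm meet_le_left)

text \<open>Leads from \<open>meet_le\<close> back to the full quasi-order: the join half of
  \<sqsubseteq> is the absorption law.\<close>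

lemma meet_below_left: "\<lbrakk>x \<in> carrier D; y \<in> carrier D\<rbrakk> \<Longrightarrow> x \<sqinter> y \<sqsubseteq> x"
  unfolding dba_le_def by (metis join_comm join_meet_absorb meet_closed meet_le_left)

lemma meet_below_right: "\<lbrakk>x \<in> carrier D; y \<in> carrier D\<rbrakk> \<Longrightarrow> x \<sqinter> y \<sqsubseteq> y"
  by (metis meet_below_left meet_comm)


section \<open>Primary filters\<close>

lemma filter_subset: "dba_filter D F \<Longrightarrow> x \<in> F \<Longrightarrow> x \<in> carrier D"
  by (auto simp: dba_filter_def)

text \<open>The element \<open>x \<sqinter> y\<close> equals \<open>x \<sqinter> x\<close> and so
  lies in \<open>F\<close>; it is below \<open>y\<close> in the full quasi-order, although
  \<open>x\<close> need not be.\<close>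

lemma filter_meet_le:
  assumes "dba_filter D F" "x \<in> F" "y \<in> carrier D" "meet_le x y"
  shows "y \<in> F"
proof -
  have "x \<in> carrier D" using assms filter_subset by blast
  moreover have "x \<sqinter> y \<in> F" using assms(1,2) unfolding assms(4) dba_filter_def by blast
  ultimately show ?thesis
    using assms meet_below_right unfolding dba_filter_def by blast
qed

lemma filter_meet_iff:
  assumes "dba_filter D F" "x \<in> carrier D" "y \<in> carrier D"
  shows "x \<sqinter> y \<in> F \<longleftrightarrow> x \<in> F \<and> y \<in> F"
  using filter_meet_le [OF assms(1) _ assms(2) meet_le_left [OF assms(2,3)]]
    filter_meet_le [OF assms(1) _ assms(3) meet_le_right [OF assms(2,3)]]
    assms(1) unfolding dba_filter_def by blast

lemma primary_filter_filter: "F \<in> primary_filters D \<Longrightarrow> dba_filter D F"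
  by (simp add: primary_filters_def)

lemma bot_notin_primary:
  assumes "F \<in> primary_filters D"
  shows "\<bottom> \<notin> F"
proof
  assume "\<bottom> \<in> F"
  then have "carrier D \<subseteq> F"
    using filter_meet_le [OF primary_filter_filter [OF assms]] by (auto simp: bot_meet bot_closed)
  then show False
    using assms unfolding primary_filters_def dba_filter_def by auto
qed

lemma primary_neg_iff:
  assumes "F \<in> primary_filters D" "x \<in> carrier D"
  shows "\<^bold>\<not> x \<in> F \<longleftrightarrow> x \<notin> F"
proof -
  have "x \<in> F \<or> \<^bold>\<not> x \<in> F"
    using assms by (simp add: primary_filters_def)
  moreover have "\<not> (x \<in> F \<and> \<^bold>\<not> x \<in> F)"
    using assms bot_notin_primary filter_meet_iff [OF primary_filter_filter]
    by (metis meet_neg neg_closed)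
  ultimately show ?thesis by blast
qed

lemma primary_meet_iff:
  "\<lbrakk>F \<in> primary_filters D; x \<in> carrier D; y \<in> carrier D\<rbrakk> \<Longrightarrow> x \<sqinter> y \<in> F \<longleftrightarrow> x \<in> F \<and> y \<in> F"
  by (simp add: filter_meet_iff primary_filter_filter)

lemma primary_vee_iff:
  "\<lbrakk>F \<in> primary_filters D; x \<in> carrier D; y \<in> carrier D\<rbrakk> \<Longrightarrow> x \<curlyvee> y \<in> F \<longleftrightarrow> x \<in> F \<or> y \<in> F"
  by (simp add: vee_def primary_neg_iff primary_meet_iff neg_closed meet_closed)

section \<open>Boolean identities for the sets of primary filters through an element\<close>

lemma filters_at_meet:
  "\<lbrakk>x \<in> carrier D; y \<in> carrier D\<rbrakk> \<Longrightarrow> filters_at D (x \<sqinter> y) = filters_at D x \<inter> filters_at D y"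
  by (auto simp: filters_at_def primary_meet_iff)

lemma filters_at_vee:
  "\<lbrakk>x \<in> carrier D; y \<in> carrier D\<rbrakk> \<Longrightarrow> filters_at D (x \<curlyvee> y) = filters_at D x \<union> filters_at D y"
  by (auto simp: filters_at_def primary_vee_iff)

lemma filters_at_neg:
  "x \<in> carrier D \<Longrightarrow> filters_at D (\<^bold>\<not> x) = primary_filters D - filters_at D x"
  by (auto simp: filters_at_def primary_neg_iff)

lemma filters_at_subset: "filters_at D x \<subseteq> primary_filters D"
  by (auto simp: filters_at_def)

lemma filters_at_bot: "filters_at D \<bottom> = {}"
  by (auto simp: filters_at_def bot_notin_primary)

lemma filters_at_neg_bot: "filters_at D (\<^bold>\<not> \<bottom>) = primary_filters D"
  by (simp add: filters_at_neg bot_closed filters_at_bot)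

lemma filters_at_neg_neg: "x \<in> carrier D \<Longrightarrow> filters_at D (\<^bold>\<not> (\<^bold>\<not> x)) = filters_at D x"
  using filters_at_subset by (auto simp: filters_at_neg neg_closed)

section \<open>Generated filters and separation by primary filters\<close>

lemma filter_principal:
  assumes "a \<in> carrier D"
  shows "dba_filter D {z \<in> carrier D. meet_le a z}"
  unfolding dba_filter_def
proof (intro conjI ballI impI)
  fix x z assume "x \<in> {z \<in> carrier D. meet_le a z}" "z \<in> carrier D" "x \<sqsubseteq> z"
  then show "z \<in> {z \<in> carrier D. meet_le a z}"
    using assms meet_le_trans [of a x z] by (auto simp: dba_le_def)
qed (use assms in \<open>auto simp: meet_closed intro!: meet_le_meet\<close>)

text \<open>For nonempty \<open>G\<close> this is the filter generated by \<open>G\<close> and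
  \<open>x\<close>. Bounds coming from \<open>g\<close> and \<open>g'\<close> are merged under the
  common lower bound \<open>(g \<sqinter> g') \<sqinter> x\<close>.\<close>

lemma filter_adjoin:
  assumes "dba_filter D G" "x \<in> carrier D"
  shows "dba_filter D {z \<in> carrier D. \<exists>g\<in>G. meet_le (g \<sqinter> x) z}" (is "dba_filter D ?H")
proof -
  have "y \<sqinter> z \<in> ?H" if "y \<in> ?H" "z \<in> ?H" for y z
  proof -
    obtain g g' where g: "g \<in> G" "meet_le (g \<sqinter> x) y" "g' \<in> G" "meet_le (g' \<sqinter> x) z"
      and yz: "y \<in> carrier D" "z \<in> carrier D"
      using \<open>y \<in> ?H\<close> \<open>z \<in> ?H\<close> by blast
    then have c: "g \<in> carrier D" "g' \<in> carrier D" using assms filter_subset by auto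
    let ?k = "(g \<sqinter> g') \<sqinter> x"
    have k: "?k \<in> carrier D" "g \<sqinter> g' \<in> carrier D" "g \<sqinter> x \<in> carrier D" "g' \<sqinter> x \<in> carrier D"
      using c assms by (auto intro: meet_closed)
    have l: "meet_le ?k x" "meet_le ?k (g \<sqinter> g')"
      using k assms by (auto intro: meet_le_left meet_le_right)
    have "meet_le ?k g" "meet_le ?k g'"
      using meet_le_trans [OF l(2) meet_le_left] meet_le_trans [OF l(2) meet_le_right] k c by auto
    then have "meet_le ?k (g \<sqinter> x)" "meet_le ?k (g' \<sqinter> x)"
      using l k c assms by (auto intro: meet_le_meet)
    then have "meet_le ?k y" "meet_le ?k z"
      using g k yz meet_le_trans by meson+
    then have "meet_le ?k (y \<sqinter> z)"
      using k yz by (intro meet_le_meet)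
    moreover have "g \<sqinter> g' \<in> G"
      using g assms unfolding dba_filter_def by blast
    ultimately show ?thesis
      using yz by (auto intro: meet_closed)
  qed
  moreover have "z \<in> ?H" if "y \<in> ?H" "z \<in> carrier D" "y \<sqsubseteq> z" for y z
  proof -
    obtain g where g: "g \<in> G" "meet_le (g \<sqinter> x) y" "y \<in> carrier D"
      using \<open>y \<in> ?H\<close> by blast
    have "g \<sqinter> x \<in> carrier D"
      using g assms filter_subset meet_closed by blast
    then have "meet_le (g \<sqinter> x) z"
      using meet_le_trans [OF g(2) _ _ g(3) that(2)] that(3) by (simp add: dba_le_def)
    then show ?thesis using g that by blast
  qed
  ultimately show ?thesis
    unfolding dba_filter_def by blast
qed

lemma filter_Union_chain:
  assumes "C \<noteq> {}" "\<And>F. F \<in> C \<Longrightarrow> dba_filter D F"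
    and "\<And>F G. \<lbrakk>F \<in> C; G \<in> C\<rbrakk> \<Longrightarrow> F \<subseteq> G \<or> G \<subseteq> F"
  shows "dba_filter D (\<Union>C)"
  unfolding dba_filter_def
proof (intro conjI ballI impI)
  show "\<Union>C \<subseteq> carrier D"
    using assms(2) filter_subset by blast
next
  fix x y assume "x \<in> \<Union>C" "y \<in> \<Union>C"
  then obtain F where "F \<in> C" "x \<in> F" "y \<in> F"
    using assms(3) by (meson UnionE subsetD)
  then show "x \<sqinter> y \<in> \<Union>C"
    using assms(2) unfolding dba_filter_def by blast
next
  fix x z assume "x \<in> \<Union>C" "z \<in> carrier D" "x \<sqsubseteq> z"
  then show "z \<in> \<Union>C"
    using assms(2) unfolding dba_filter_def by blast
qed

text \<open>Stone's argument: a filter maximal among those that contain \<open>a\<close> and avoid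
  \<open>J\<close> is primary. The hypothesis speaks of \<open>a \<sqinter> a\<close> because every
  filter through \<open>a\<close> contains it, while \<open>down\<close> can only place
  \<sqinter>-idempotent elements in \<open>J\<close>.\<close>

lemma primary_filter_separation:
  assumes a: "a \<in> carrier D" "a \<sqinter> a \<notin> J"
    and J: "J \<subseteq> carrier D" "J \<noteq> {}"
    and down: "\<And>z i. \<lbrakk>z \<in> carrier D; i \<in> J; z \<sqinter> i = z\<rbrakk> \<Longrightarrow> z \<in> J"
    and vee: "\<And>x y. \<lbrakk>x \<in> J; y \<in> J\<rbrakk> \<Longrightarrow> x \<curlyvee> y \<in> J"
  obtains G where "G \<in> primary_filters D" "a \<in> G" "G \<inter> J = {}"
proof -
  let ?A = "{G. dba_filter D G \<and> a \<in> G \<and> G \<inter> J = {}}"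
  \<comment> \<open>The principal filter of \<open>a\<close> avoids \<open>J\<close>, so the family
    given to Zorn's lemma is nonempty.\<close>
  have "z \<notin> J" if z: "z \<in> carrier D" "meet_le a z" for z
  proof
    assume "z \<in> J"
    moreover have "(a \<sqinter> a) \<sqinter> z = a \<sqinter> a"
      using meet_idem_left [OF a(1) z(1)] z(2) by simp
    ultimately show False
      using a(2) down [OF meet_closed [OF a(1,1)]] by blast
  qed
  then have "{z \<in> carrier D. meet_le a z} \<inter> J = {}"
    by blast
  then have "{z \<in> carrier D. meet_le a z} \<in> ?A"
    using a filter_principal by auto
  then have ne: "?A \<noteq> {}" by blast
  have "\<Union>C \<in> ?A" if "C \<noteq> {}" "subset.chain ?A C" for C
  proof -
    have "dba_filter D (\<Union>C)"
      using that by (intro filter_Union_chain) (auto simp: subset.chain_def)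
    then show ?thesis
      using that unfolding subset.chain_def by blast
  qed
  from subset_Zorn_nonempty [OF ne this] obtain G
    where "G \<in> ?A" and maximal: "\<forall>H\<in>?A. G \<subseteq> H \<longrightarrow> H = G"
    by (rule bexE)
  then have G: "dba_filter D G" "a \<in> G" "G \<inter> J = {}"
    by simp_all
  have max: "H = G" if "dba_filter D H" "a \<in> H" "H \<inter> J = {}" "G \<subseteq> H" for H
    using maximal that by simp
  \<comment> \<open>By maximality, adjoining \<open>x\<close> to \<open>G\<close> must produce a
    filter that hits \<open>J\<close>.\<close>
  have meets: "\<exists>g\<in>G. g \<sqinter> x \<in> J" if x: "x \<in> carrier D" "x \<notin> G" for x
  proof -
    let ?H = "{z \<in> carrier D. \<exists>g\<in>G. meet_le (g \<sqinter> x) z}"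
    have "G \<subseteq> ?H"
      using filter_subset [OF G(1)] x meet_le_left by blast
    moreover have "x \<in> ?H"
      using G filter_subset [OF G(1)] x meet_le_right by blast
    ultimately have "?H \<inter> J \<noteq> {}"
      using max [OF filter_adjoin [OF G(1) x(1)]] G(2) x(2) by blast
    then obtain g i where "g \<in> G" "i \<in> J" "meet_le (g \<sqinter> x) i" by blast
    moreover have "g \<sqinter> x \<in> carrier D" "(g \<sqinter> x) \<sqinter> (g \<sqinter> x) = g \<sqinter> x"
      using \<open>g \<in> G\<close> x filter_subset [OF G(1)] by (auto intro: meet_closed meet_meet_idem)
    ultimately show ?thesis using down [of "g \<sqinter> x" i] by auto
  qed
  have shrink: "(g \<sqinter> h) \<sqinter> x \<in> J"
    if "g \<sqinter> x \<in> J" "g \<in> carrier D" "h \<in> carrier D" "x \<in> carrier D" for g h x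
  proof (rule down)
    have "(g \<sqinter> h) \<sqinter> x = h \<sqinter> (g \<sqinter> x)"
      using that by (simp add: meet_assoc meet_comm [of g h])
    then show "(g \<sqinter> h) \<sqinter> x \<sqinter> (g \<sqinter> x) = (g \<sqinter> h) \<sqinter> x"
      using that by (simp add: meet_closed meet_le_right meet_meet_idem)
  qed (use that in \<open>auto intro: meet_closed\<close>)
  \<comment> \<open>If both fail, the meets of \<open>g \<sqinter> h\<close> with \<open>x\<close>
    and with \<not>\<open>x\<close> lie in \<open>J\<close>. Their \<curlyvee> is
    \<open>g \<sqinter> h\<close> itself, which lies in \<open>G\<close>.\<close>
  have "x \<in> G \<or> \<^bold>\<not> x \<in> G" if x: "x \<in> carrier D" for x
  proof (rule ccontr)
    assume "\<not> (x \<in> G \<or> \<^bold>\<not> x \<in> G)"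
    then obtain g h where gh: "g \<in> G" "g \<sqinter> x \<in> J" "h \<in> G" "h \<sqinter> \<^bold>\<not> x \<in> J"
      using meets neg_closed x by metis
    then have c: "g \<in> carrier D" "h \<in> carrier D" using filter_subset [OF G(1)] by auto
    have "(g \<sqinter> h) \<sqinter> x \<in> J" "(g \<sqinter> h) \<sqinter> \<^bold>\<not> x \<in> J"
      using shrink [of g x h] shrink [of h "\<^bold>\<not> x" g] gh c x
      by (auto simp: neg_closed meet_comm)
    then have "g \<sqinter> h \<in> J"
      using vee meet_vee_neg [of "g \<sqinter> h" x] c x by (metis meet_closed meet_meet_idem)
    moreover have "g \<sqinter> h \<in> G"
      using gh c G(1) by (simp add: filter_meet_iff)
    ultimately show False using G(3) by blast
  qed
  moreover have "G \<noteq> carrier D" using G J by blast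
  ultimately have "G \<in> primary_filters D"
    using G(1) by (simp add: primary_filters_def)
  then show thesis using that G by blast
qed

lemma filters_at_subset_iff:
  assumes "x \<in> carrier D" "y \<in> carrier D"
  shows "filters_at D x \<subseteq> filters_at D y \<longleftrightarrow> meet_le x y"
proof
  assume sub: "filters_at D x \<subseteq> filters_at D y"
  \<comment> \<open>The Boolean difference: a primary filter through it contains \<open>x\<close>
    but not \<open>y\<close>.\<close>
  let ?a = "x \<sqinter> \<^bold>\<not> y"
  have "?a = \<bottom>"
  proof (rule ccontr)
    assume "?a \<noteq> \<bottom>"
    then have "?a \<sqinter> ?a \<notin> {\<bottom>}" using assms by (simp add: meet_meet_idem neg_closed)
    then obtain G where "G \<in> primary_filters D" "?a \<in> G"
      using primary_filter_separation [of ?a "{\<bottom>}"] assms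
      by (metis (no_types, lifting) bot_closed bot_meet bot_vee_bot empty_subsetI insert_not_empty
          insert_subset meet_closed meet_comm neg_closed singletonD singletonI)
    then show False
      using sub assms by (auto simp: filters_at_def primary_meet_iff primary_neg_iff neg_closed)
  qed
  \<comment> \<open>The element \<open>x \<sqinter> x\<close> splits into
    \<open>x \<sqinter> y\<close> and the difference, which has just been shown to be
    \<bottom>.\<close>
  then show "meet_le x y"
    using meet_vee_neg [of x y] vee_bot [of x y] assms by simp
next
  assume "meet_le x y"
  then show "filters_at D x \<subseteq> filters_at D y"
    using assms filter_meet_le primary_filter_filter by (auto simp: filters_at_def)
qed

lemma filter_ideal_separation:
  assumes "a \<in> carrier D" "I \<in> primary_ideals D" "a \<sqinter> a \<notin> I"
  obtains F where "F \<in> primary_filters D" "a \<in> F" "F \<inter> I = {}"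
proof -
  have I: "dba_ideal D I" using assms by (simp add: primary_ideals_def)
  then have sub: "I \<subseteq> carrier D" by (simp add: dba_ideal_def)
  have down: "z \<in> I" if "z \<in> carrier D" "i \<in> I" "z \<sqinter> i = z" for z i
    using that I sub meet_below_right [of z i] unfolding dba_ideal_def by auto
  have vee: "x \<curlyvee> y \<in> I" if xy: "x \<in> I" "y \<in> I" for x y
  proof (rule down)
    show "x \<squnion> y \<in> I" using xy I unfolding dba_ideal_def by blast
    show "x \<curlyvee> y \<in> carrier D" "(x \<curlyvee> y) \<sqinter> (x \<squnion> y) = x \<curlyvee> y"
      using xy sub by (simp_all add: vee_closed vee_meet_join subset_iff)
  qed
  \<comment> \<open>A primary ideal contains \<top> or its opposition.\<close>
  have "I \<noteq> {}"
    using assms(2) top_closed unfolding primary_ideals_def by blast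
  then show thesis
    by (rule primary_filter_separation [OF assms(1,3) sub _ down vee]) (use that in blast)+
qed


section \<open>Clopen sets of primary filters\<close>

text \<open>If \<open>a \<sqinter> a\<close> were outside \<open>?J\<close>, some primary filter
  through \<open>a\<close> would avoid \<open>?J\<close>. By the covering it contains some
  \<open>x\<close> in \<open>S\<close>, and \<open>x\<close> is in \<open>?J\<close> with the
  subcover \<open>{x}\<close>.\<close>

lemma filters_at_compact:
  assumes "a \<in> carrier D" "S \<subseteq> carrier D" "filters_at D a \<subseteq> (\<Union>x\<in>S. filters_at D x)"
  obtains T where "finite T" "T \<subseteq> S" "filters_at D a \<subseteq> (\<Union>x\<in>T. filters_at D x)"
proof -
  let ?J = "{z \<in> carrier D. \<exists>T. finite T \<and> T \<subseteq> S \<and> filters_at D z \<subseteq> (\<Union>x\<in>T. filters_at D x)}"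
  have "a \<sqinter> a \<in> ?J"
  proof (rule ccontr)
    assume notin: "a \<sqinter> a \<notin> ?J"
    have "\<bottom> \<in> ?J" by (auto simp: bot_closed filters_at_bot)
    then have ne: "?J \<noteq> {}" by blast
    have down: "z \<in> ?J" if "z \<in> carrier D" "i \<in> ?J" "z \<sqinter> i = z" for z i
    proof -
      have "filters_at D z \<subseteq> filters_at D i"
        using that filters_at_meet [of z i] by auto
      then show ?thesis using that by blast
    qed
    have vee: "x \<curlyvee> y \<in> ?J" if xy: "x \<in> ?J" "y \<in> ?J" for x y
    proof -
      obtain T U where "finite T" "T \<subseteq> S" "filters_at D x \<subseteq> (\<Union>x\<in>T. filters_at D x)"
        "finite U" "U \<subseteq> S" "filters_at D y \<subseteq> (\<Union>x\<in>U. filters_at D x)"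
        using xy by blast
      then have "finite (T \<union> U)" "T \<union> U \<subseteq> S"
        "filters_at D (x \<curlyvee> y) \<subseteq> (\<Union>x\<in>T \<union> U. filters_at D x)"
        using xy by (auto simp: filters_at_vee)
      then show ?thesis using xy vee_closed by blast
    qed
    obtain G where G: "G \<in> primary_filters D" "a \<in> G" "G \<inter> ?J = {}"
      by (rule primary_filter_separation [OF assms(1) notin _ ne down vee]) auto
    then obtain x where "x \<in> S" "x \<in> G"
      using assms(3) by (auto simp: filters_at_def)
    moreover from \<open>x \<in> S\<close> have "x \<in> ?J"
      using assms(2) by (auto intro!: exI [of _ "{x}"])
    ultimately show False using G(3) by blast
  qed
  then show thesis
    using that assms(1) by (auto simp: filters_at_meet)
qed

lemma finite_Union_filters_at:
  assumes "finite T" "T \<subseteq> carrier D"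
  shows "\<exists>c\<in>carrier D. (\<Union>x\<in>T. filters_at D x) = filters_at D c"
  using assms
proof (induction T rule: finite_induct)
  case empty
  then show ?case using bot_closed filters_at_bot by auto
next
  case (insert x T)
  then obtain c where c: "c \<in> carrier D" "(\<Union>x\<in>T. filters_at D x) = filters_at D c" by auto
  then have "(\<Union>x\<in>insert x T. filters_at D x) = filters_at D (x \<curlyvee> c)"
    using insert by (simp add: filters_at_vee)
  then show ?case
    using c insert vee_closed by (metis insert_subset)
qed

section \<open>The topology on primary filters and its clopen sets\<close>

abbreviation filter_space :: "'a set topology"
  where "filter_space \<equiv> closed_subbase_topology (primary_filters D) (filters_at D ` carrier D)"

lemma topspace_filter_space: "topspace filter_space = primary_filters D"
  unfolding closed_subbase_topology_def by (rule topspace_subbase)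

text \<open>Complements of subbasic closed sets are again of the form \<open>filters_at D x\<close>,
  through negation, and these sets are closed under finite intersections. Hence they form a base of
  open sets.\<close>

lemma openin_filter_space:
  "openin filter_space U \<longleftrightarrow> (\<exists>S\<subseteq>carrier D. U = (\<Union>x\<in>S. filters_at D x))"
proof -
  let ?P = "\<lambda>U. \<exists>C\<in>filters_at D ` carrier D. U = primary_filters D - C"
  have fin: "\<exists>x\<in>carrier D. primary_filters D \<inter> \<Inter>\<U> = filters_at D x"
    if "finite \<U>" "\<U> \<subseteq> Collect ?P" for \<U>
    using that
  proof (induction \<U> rule: finite_induct)
    case empty
    then show ?case using filters_at_neg_bot bot_closed neg_closed by auto
  next
    case (insert V \<U>)
    then obtain x y where "x \<in> carrier D" "primary_filters D \<inter> \<Inter>\<U> = filters_at D x"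
      and "y \<in> carrier D" "V = primary_filters D - filters_at D y" by auto
    then have "primary_filters D \<inter> \<Inter>(insert V \<U>) = filters_at D (x \<sqinter> \<^bold>\<not> y)"
      by (auto simp: filters_at_meet filters_at_neg neg_closed)
    then show ?case
      using \<open>x \<in> _\<close> \<open>y \<in> _\<close> meet_closed neg_closed by metis
  qed
  have base: "(finite intersection_of ?P relative_to primary_filters D) V
      \<longleftrightarrow> V \<in> filters_at D ` carrier D" for V
  proof
    assume "(finite intersection_of ?P relative_to primary_filters D) V"
    then show "V \<in> filters_at D ` carrier D"
      using fin unfolding relative_to_def intersection_of_def by blast
  next
    assume "V \<in> filters_at D ` carrier D"
    then obtain x where x: "x \<in> carrier D" "V = filters_at D x" by blast
    then have V: "V = primary_filters D - filters_at D (\<^bold>\<not> x)"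
      using filters_at_neg_neg filters_at_neg neg_closed by metis
    then have "(finite intersection_of ?P) V"
      using x neg_closed by (intro finite_intersection_of_inc) blast
    then show "(finite intersection_of ?P relative_to primary_filters D) V"
      unfolding relative_to_def using V by blast
  qed
  have "openin filter_space U \<longleftrightarrow> (arbitrary union_of (\<lambda>V. V \<in> filters_at D ` carrier D)) U"
    unfolding closed_subbase_topology_def openin_subbase base ..
  also have "\<dots> \<longleftrightarrow> (\<exists>S\<subseteq>carrier D. U = (\<Union>x\<in>S. filters_at D x))"
    unfolding union_of_def arbitrary_def
    by (auto simp: subset_image_iff)
  finally show ?thesis .
qed

lemma clopenin_filter_space:
  "clopenin filter_space A \<longleftrightarrow> (\<exists>x\<in>carrier D. A = filters_at D x)"
proof
  assume A: "clopenin filter_space A"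
  then have sub: "A \<subseteq> primary_filters D"
    using closedin_subset [of filter_space A] by (simp add: clopenin_def topspace_filter_space)
  obtain S S' where S: "S \<subseteq> carrier D" "A = (\<Union>x\<in>S. filters_at D x)"
    "S' \<subseteq> carrier D" "primary_filters D - A = (\<Union>x\<in>S'. filters_at D x)"
    using A unfolding clopenin_def closedin_def topspace_filter_space openin_filter_space by blast
  \<comment> \<open>The whole space is the set belonging to \<not>\<bottom>, so compactness applies
    to its cover by basic sets inside \<open>A\<close> and inside the complement. The finitely many
    chosen from \<open>S\<close> already exhaust \<open>A\<close>.\<close>
  have cover: "filters_at D (\<^bold>\<not> \<bottom>) \<subseteq> (\<Union>x\<in>S \<union> S'. filters_at D x)"
    unfolding filters_at_neg_bot UN_Un S(2,4) [symmetric] by blast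
  obtain T where T: "finite T" "T \<subseteq> S \<union> S'" "filters_at D (\<^bold>\<not> \<bottom>) \<subseteq> (\<Union>x\<in>T. filters_at D x)"
    by (rule filters_at_compact [OF _ _ cover]) (use S in \<open>auto intro: neg_closed bot_closed\<close>)
  have "A = (\<Union>x\<in>T \<inter> S. filters_at D x)"
  proof
    show "A \<subseteq> (\<Union>x\<in>T \<inter> S. filters_at D x)"
    proof
      fix F assume "F \<in> A"
      then obtain x where "x \<in> T" "F \<in> filters_at D x"
        using sub T(3) unfolding filters_at_neg_bot by blast
      moreover have "x \<notin> S'" using \<open>F \<in> A\<close> \<open>F \<in> filters_at D x\<close> S(4) by blast
      ultimately show "F \<in> (\<Union>x\<in>T \<inter> S. filters_at D x)" using T(2) by blast
    qed
  qed (use S(2) in blast)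
  then show "\<exists>x\<in>carrier D. A = filters_at D x"
    using finite_Union_filters_at [of "T \<inter> S"] T(1) S(1) by (metis finite_Int le_infI2)
next
  have "openin filter_space (filters_at D x)" if "x \<in> carrier D" for x
    unfolding openin_filter_space using that by (auto intro: exI [of _ "{x}"])
  moreover assume "\<exists>x\<in>carrier D. A = filters_at D x"
  ultimately show "clopenin filter_space A"
    unfolding clopenin_def closedin_def topspace_filter_space
    using filters_at_neg filters_at_subset neg_closed by metis
qed

end


section \<open>Algebras of object oriented protoconcepts\<close>

text \<open>Diamond is left adjoint to box; the triple-composition identities below are formal
  consequences of this Galois connection.\<close>

lemma oo_diamond_le_iff:
  assumes "B \<subseteq> topspace (attributes K)"
  shows "oo_diamond K B \<subseteq> A \<longleftrightarrow> B \<subseteq> oo_box K A"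
  using assms unfolding oo_diamond_def oo_box_def by blast

lemma oo_box_subset: "oo_box K A \<subseteq> topspace (attributes K)"
  by (auto simp: oo_box_def)

lemma oo_box_mono: "A \<subseteq> A' \<Longrightarrow> oo_box K A \<subseteq> oo_box K A'"
  by (auto simp: oo_box_def)

lemma oo_diamond_mono: "B \<subseteq> B' \<Longrightarrow> oo_diamond K B \<subseteq> oo_diamond K B'"
  by (auto simp: oo_diamond_def)

lemma oo_box_topspace: "oo_box K (topspace (objects K)) = topspace (attributes K)"
  by (auto simp: oo_box_def)

lemma oo_diamond_empty: "oo_diamond K {} = {}"
  by (auto simp: oo_diamond_def)

lemma oo_diamond_box_subset: "oo_diamond K (oo_box K A) \<subseteq> A"
  by (simp add: oo_diamond_le_iff oo_box_subset)

lemma oo_box_diamond_box: "oo_box K (oo_diamond K (oo_box K A)) = oo_box K A"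
  by (metis oo_box_mono oo_box_subset oo_diamond_box_subset oo_diamond_le_iff subset_antisym
      subset_refl)

lemma oo_diamond_box_diamond:
  "B \<subseteq> topspace (attributes K) \<Longrightarrow> oo_diamond K (oo_box K (oo_diamond K B)) = oo_diamond K B"
  by (metis oo_diamond_box_subset oo_diamond_le_iff oo_diamond_mono subset_antisym subset_refl)

lemma oo_semiconcepts_subset: "oo_semiconcepts K \<subseteq> oo_protoconcepts K"
  by (auto simp: oo_semiconcepts_def oo_protoconcepts_def oo_diamond_box_diamond)

lemma oo_algebra_simps [simp]:
  "carrier (oo_algebra K P) = P"
  "join (oo_algebra K P) (A, B) (C, E) = (oo_diamond K (B \<inter> E), B \<inter> E)"
  "meet (oo_algebra K P) (A, B) (C, E) = (A \<union> C, oo_box K (A \<union> C))"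
  "neg (oo_algebra K P) (A, B) =
    (topspace (objects K) - A, oo_box K (topspace (objects K) - A))"
  "opp (oo_algebra K P) (A, B) =
    (oo_diamond K (topspace (attributes K) - B), topspace (attributes K) - B)"
  "top_elem (oo_algebra K P) = ({}, {})"
  "bot_elem (oo_algebra K P) = (topspace (objects K), topspace (attributes K))"
  by (simp_all add: oo_algebra_def)


text \<open>Stated for any family \<open>P\<close> of protoconcepts closed under the operations, so
  that protoconcepts and semiconcepts are handled together.\<close>

lemma dba_oo_algebra:
  assumes P: "P \<subseteq> oo_protoconcepts K"
    and meet: "\<And>A B C E. \<lbrakk>(A, B) \<in> P; (C, E) \<in> P\<rbrakk> \<Longrightarrow> (A \<union> C, oo_box K (A \<union> C)) \<in> P"
    and join: "\<And>A B C E. \<lbrakk>(A, B) \<in> P; (C, E) \<in> P\<rbrakk> \<Longrightarrow> (oo_diamond K (B \<inter> E), B \<inter> E) \<in> P"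
    and neg: "\<And>A B. (A, B) \<in> P \<Longrightarrow>
      (topspace (objects K) - A, oo_box K (topspace (objects K) - A)) \<in> P"
    and opp: "\<And>A B. (A, B) \<in> P \<Longrightarrow>
      (oo_diamond K (topspace (attributes K) - B), topspace (attributes K) - B) \<in> P"
    and top: "({}, {}) \<in> P"
    and bot: "(topspace (objects K), topspace (attributes K)) \<in> P"
  shows "dba (oo_algebra K P)"
proof -
  have sub: "A \<subseteq> topspace (objects K)" "B \<subseteq> topspace (attributes K)" if "(A, B) \<in> P" for A B
    using that P by (auto simp: oo_protoconcepts_def)
  have dia: "oo_diamond K (oo_box K A) = oo_diamond K B" if "(A, B) \<in> P" for A B
    using that P by (auto simp: oo_protoconcepts_def)
  have box: "oo_box K A = oo_box K (oo_diamond K B)" if "(A, B) \<in> P" for A B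
    using dia [OF that] oo_box_diamond_box by metis
  \<comment> \<open>This inclusion and the next one give the two absorption laws between \<sqinter>
    and \<squnion>.\<close>
  have le_dia: "oo_diamond K (B \<inter> E) \<subseteq> A" if "(A, B) \<in> P" for A B E
    using dia [OF that] oo_diamond_box_subset oo_diamond_mono by (metis inf_le1 subset_trans)
  have le_box: "B \<subseteq> oo_box K (A \<union> C)" if "(A, B) \<in> P" for A B C
    using le_dia [OF that, of B] sub [OF that] by (simp add: oo_diamond_le_iff [symmetric] le_supI1)
  have dd: "X - (X - A \<union> (X - C)) = A \<inter> C" "X - ((X - A) \<inter> (X - C)) = A \<union> C"
    if "A \<subseteq> X" "C \<subseteq> X" for X A C :: "'x set"
    using that by blast+
  have absorb: "A \<union> oo_diamond K (B \<inter> E) = A" "B \<inter> oo_box K (A \<union> C) = B"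
    "topspace (objects K) \<union> A = topspace (objects K)"
    "A \<union> topspace (objects K) = topspace (objects K)"
    if "(A, B) \<in> P" for A B C E
    using le_dia [OF that] le_box [OF that] sub [OF that] by blast+
  show ?thesis
    \<comment> \<open>The goal left to \<open>metis\<close> is \<open>meet_join_idem\<close>; it
      compares the diamond and box of the two components, which is the protoconcept
      condition.\<close>
    by unfold_locales
      (simp_all add: vee_def wedge_def split_paired_all meet join neg opp top bot
        oo_box_topspace oo_diamond_empty absorb Un_ac Int_ac dd sub double_diff le_infI1 le_supI
        Un_Int_distrib [symmetric] Int_Un_distrib [symmetric], metis dia box)
qed


section \<open>The representation\<close>

context dba
begin

lemma filters_at_top: "filters_at D \<top> = primary_filters D"
  using filters_at_neg_bot filters_at_meet [OF top_closed top_closed] by (simp add: neg_bot)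

lemma filters_at_neg_meet:
  "\<lbrakk>x \<in> carrier D; y \<in> carrier D\<rbrakk>
    \<Longrightarrow> filters_at D (\<^bold>\<not> (x \<sqinter> y)) = filters_at D (\<^bold>\<not> x) \<union> filters_at D (\<^bold>\<not> y)"
  by (auto simp: filters_at_neg filters_at_meet meet_closed)

text \<open>Filter facts read in the dual dBa; the bounds are exchanged, so \<top> now gives the
  empty set and \<bottom> the whole space.\<close>

lemmas ideals_at_join = dba.filters_at_meet [OF dba_dual, unfolded filters_at_dual dba_dual_simps]
  and ideals_at_opp =
    dba.filters_at_neg [OF dba_dual, unfolded filters_at_dual primary_filters_dual dba_dual_simps]
  and ideals_at_top = dba.filters_at_bot [OF dba_dual, unfolded filters_at_dual dba_dual_simps]
  and ideals_at_bot =
    dba.filters_at_top [OF dba_dual, unfolded filters_at_dual primary_filters_dual dba_dual_simps]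
  and ideals_at_subset_iff =
    dba.filters_at_subset_iff [OF dba_dual, unfolded filters_at_dual dba_dual_simps]
  and ideal_filter_separation =
    dba.filter_ideal_separation
      [OF dba_dual, unfolded primary_filters_dual primary_ideals_dual dba_dual_simps]
  and primary_ideal_join_iff =
    dba.primary_meet_iff [OF dba_dual, unfolded primary_filters_dual dba_dual_simps]
  and join_join_idem = dba.meet_meet_idem [OF dba_dual, unfolded dba_dual_simps]
  and opp_idem = dba.neg_idem [OF dba_dual, unfolded dba_dual_simps]

section \<open>Box and diamond on the clopen sets of the primary context\<close>

lemma topspace_objects: "topspace (objects (primary_context D)) = primary_filters D"
  by (simp add: primary_context_def topspace_filter_space)

lemma topspace_attributes: "topspace (attributes (primary_context D)) = primary_ideals D"
  using dba.topspace_filter_space [OF dba_dual]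
  by (simp add: primary_context_def filters_at_dual primary_filters_dual)

lemma clopenin_objects:
  "clopenin (objects (primary_context D)) A \<longleftrightarrow> (\<exists>x\<in>carrier D. A = filters_at D x)"
  by (simp add: primary_context_def clopenin_filter_space)

lemma clopenin_attributes:
  "clopenin (attributes (primary_context D)) B \<longleftrightarrow> (\<exists>x\<in>carrier D. B = ideals_at D x)"
  using dba.clopenin_filter_space [OF dba_dual]
  by (simp add: primary_context_def filters_at_dual primary_filters_dual)

text \<open>If \<open>x \<sqinter> x\<close> is not in \<open>I\<close>, separation yields a primary
  filter through \<open>x\<close> disjoint from \<open>I\<close>, and it omits
  \<not>\<open>x\<close>. Conversely, a filter through \<open>x\<close> contains
  \<open>x \<sqinter> x\<close> and so cannot be disjoint from an \<open>I\<close> containing that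
  element.\<close>

lemma oo_box_filters_at:
  assumes "x \<in> carrier D"
  shows "oo_box (primary_context D) (filters_at D (\<^bold>\<not> x)) = ideals_at D (x \<sqinter> x)"
proof -
  have "(\<forall>F\<in>primary_filters D. F \<inter> I = {} \<longrightarrow> \<^bold>\<not> x \<in> F) \<longleftrightarrow> x \<sqinter> x \<in> I"
    if I: "I \<in> primary_ideals D" for I
  proof
    assume "\<forall>F\<in>primary_filters D. F \<inter> I = {} \<longrightarrow> \<^bold>\<not> x \<in> F"
    then show "x \<sqinter> x \<in> I"
      using filter_ideal_separation [OF assms I] primary_neg_iff assms by metis
  next
    assume "x \<sqinter> x \<in> I"
    then show "\<forall>F\<in>primary_filters D. F \<inter> I = {} \<longrightarrow> \<^bold>\<not> x \<in> F"
      using assms primary_neg_iff primary_meet_iff by (metis disjoint_iff)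
  qed
  then show ?thesis
    unfolding oo_box_def topspace_objects topspace_attributes
    by (auto simp: primary_context_def filters_at_def ideals_at_def)
qed

text \<open>The dual separation: when \<open>x \<squnion> x\<close> is outside \<open>F\<close>, a
  primary ideal through \<open>x\<close> avoids \<open>F\<close>.\<close>

lemma oo_diamond_ideals_at:
  assumes "x \<in> carrier D"
  shows "oo_diamond (primary_context D) (ideals_at D x) = filters_at D (\<^bold>\<not> (x \<squnion> x))"
proof -
  have meets: "(\<exists>I\<in>primary_ideals D. F \<inter> I = {} \<and> x \<in> I) \<longleftrightarrow> x \<squnion> x \<notin> F"
    if F: "F \<in> primary_filters D" for F
  proof
    assume "\<exists>I\<in>primary_ideals D. F \<inter> I = {} \<and> x \<in> I"
    then show "x \<squnion> x \<notin> F"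
      using assms primary_ideal_join_iff by (metis disjoint_iff)
  next
    assume "x \<squnion> x \<notin> F"
    then show "\<exists>I\<in>primary_ideals D. F \<inter> I = {} \<and> x \<in> I"
      using ideal_filter_separation [OF assms F] by (metis inf_commute)
  qed
  have "{I \<in> primary_ideals D. F \<inter> I = {}} \<inter> ideals_at D x \<noteq> {} \<longleftrightarrow> \<^bold>\<not> (x \<squnion> x) \<in> F"
    if "F \<in> primary_filters D" for F
    unfolding ideals_at_def primary_neg_iff [OF that join_closed [OF assms assms]]
      meets [OF that, symmetric] by blast
  then show ?thesis
    unfolding oo_diamond_def topspace_objects topspace_attributes
    by (simp add: primary_context_def filters_at_def cong: conj_cong)
qed

text \<open>Box preserves clopen sets: a clopen \<open>A\<close> belongs to some \<open>x\<close>,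
  hence also to its double negation, and \<open>oo_box_filters_at\<close> applies to
  \<not>\<open>x\<close>.\<close>

lemma clopen_box_semiconcept:
  assumes "clopenin (objects (primary_context D)) A"
  shows "(A, oo_box (primary_context D) A)
    \<in> oo_semiconcepts (primary_context D) \<inter> clopen_pairs (primary_context D)"
proof -
  obtain x where x: "x \<in> carrier D" "A = filters_at D x"
    using assms clopenin_objects by blast
  then have "oo_box (primary_context D) A = ideals_at D (\<^bold>\<not> x \<sqinter> \<^bold>\<not> x)"
    using oo_box_filters_at [of "\<^bold>\<not> x"] filters_at_neg_neg neg_closed by simp
  then have "clopenin (attributes (primary_context D)) (oo_box (primary_context D) A)"
    using x neg_closed meet_closed clopenin_attributes by metis
  then show ?thesis
    using assms unfolding oo_semiconcepts_def clopen_pairs_def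
    by (auto simp: clopenin_def closedin_def oo_box_def)
qed

lemma clopen_diamond_semiconcept:
  assumes "clopenin (attributes (primary_context D)) B"
  shows "(oo_diamond (primary_context D) B, B)
    \<in> oo_semiconcepts (primary_context D) \<inter> clopen_pairs (primary_context D)"
proof -
  have "clopenin (objects (primary_context D)) (oo_diamond (primary_context D) B)"
    using assms oo_diamond_ideals_at clopenin_attributes clopenin_objects neg_closed join_closed
    by metis
  then show ?thesis
    using assms unfolding oo_semiconcepts_def clopen_pairs_def
    by (auto simp: clopenin_def closedin_def oo_diamond_def)
qed

text \<open>Every operation returns a pair \<open>(A, oo_box K A)\<close> or
  \<open>(oo_diamond K B, B)\<close> with the leading component clopen, hence a clopen semiconcept.
  Any \<open>Q\<close> between semiconcepts and protoconcepts is therefore closed.\<close>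

lemma dba_clopen_algebra:
  assumes "oo_semiconcepts (primary_context D) \<subseteq> Q" "Q \<subseteq> oo_protoconcepts (primary_context D)"
  shows "dba (oo_algebra (primary_context D) (Q \<inter> clopen_pairs (primary_context D)))"
proof (rule dba_oo_algebra)
  let ?K = "primary_context D" and ?P = "Q \<inter> clopen_pairs (primary_context D)"
  have box: "(A, oo_box ?K A) \<in> ?P" if "clopenin (objects ?K) A" for A
    using clopen_box_semiconcept [OF that] assms by blast
  have dia: "(oo_diamond ?K B, B) \<in> ?P" if "clopenin (attributes ?K) B" for B
    using clopen_diamond_semiconcept [OF that] assms by blast
  show "({}, {}) \<in> ?P"
    using dia [of "{}"] by (simp add: oo_diamond_empty clopenin_def)
  show "(topspace (objects ?K), topspace (attributes ?K)) \<in> ?P"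
    using box [of "topspace (objects ?K)"] by (simp add: oo_box_topspace clopenin_def)
  show "(topspace (objects ?K) - A, oo_box ?K (topspace (objects ?K) - A)) \<in> ?P"
    "(oo_diamond ?K (topspace (attributes ?K) - B), topspace (attributes ?K) - B) \<in> ?P"
    if "(A, B) \<in> ?P" for A B
    using that by (intro box dia; auto simp: clopen_pairs_def clopenin_def)+
  show "(A \<union> C, oo_box ?K (A \<union> C)) \<in> ?P" "(oo_diamond ?K (B \<inter> E), B \<inter> E) \<in> ?P"
    if "(A, B) \<in> ?P" "(C, E) \<in> ?P" for A B C E
    using that by (intro box dia; auto simp: clopen_pairs_def clopenin_def)+
qed (use assms in blast)

section \<open>The representation map: homomorphism, values and order\<close>

abbreviation representation :: "'a \<Rightarrow> 'a set set \<times> 'a set set"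
  where "representation x \<equiv> (filters_at D (\<^bold>\<not> x), ideals_at D x)"

text \<open>The operations do not depend on the carrier \<open>P\<close>, so one computation serves
  both target algebras. The doubled element in the box and diamond formulas disappears because
  results of operations are idempotent.\<close>

lemma representation_hom:
  fixes P
  defines "E \<equiv> oo_algebra (primary_context D) P"
  shows "\<lbrakk>x \<in> carrier D; y \<in> carrier D\<rbrakk>
      \<Longrightarrow> representation (x \<squnion> y) = representation x \<squnion>\<^bsub>E\<^esub> representation y"
    and "\<lbrakk>x \<in> carrier D; y \<in> carrier D\<rbrakk>
      \<Longrightarrow> representation (x \<sqinter> y) = representation x \<sqinter>\<^bsub>E\<^esub> representation y"
    and "x \<in> carrier D \<Longrightarrow> representation (\<^bold>\<not> x) = \<^bold>\<not>\<^bsub>E\<^esub> representation x"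
    and "x \<in> carrier D \<Longrightarrow> representation (\<^bold>\<rfloor> x) = \<^bold>\<rfloor>\<^bsub>E\<^esub> representation x"
    and "representation \<top> = \<top>\<^bsub>E\<^esub>" and "representation \<bottom> = \<bottom>\<^bsub>E\<^esub>"
proof -
  let ?K = "primary_context D"
  show "representation (x \<squnion> y) = representation x \<squnion>\<^bsub>E\<^esub> representation y"
    if xy: "x \<in> carrier D" "y \<in> carrier D"
  proof -
    have "oo_diamond ?K (ideals_at D (x \<squnion> y)) = filters_at D (\<^bold>\<not> (x \<squnion> y))"
      using xy by (simp add: oo_diamond_ideals_at join_closed join_join_idem)
    then show ?thesis
      unfolding E_def oo_algebra_simps ideals_at_join [OF xy] by simp
  qed
  show "representation (x \<sqinter> y) = representation x \<sqinter>\<^bsub>E\<^esub> representation y"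
    if xy: "x \<in> carrier D" "y \<in> carrier D"
  proof -
    have "oo_box ?K (filters_at D (\<^bold>\<not> (x \<sqinter> y))) = ideals_at D (x \<sqinter> y)"
      using xy by (simp add: oo_box_filters_at meet_closed meet_meet_idem)
    then show ?thesis
      unfolding E_def oo_algebra_simps filters_at_neg_meet [OF xy] by simp
  qed
  show "representation (\<^bold>\<not> x) = \<^bold>\<not>\<^bsub>E\<^esub> representation x" if x: "x \<in> carrier D"
  proof -
    have "oo_box ?K (filters_at D (\<^bold>\<not> (\<^bold>\<not> x))) = ideals_at D (\<^bold>\<not> x)"
      using x by (simp add: oo_box_filters_at neg_closed neg_idem)
    then show ?thesis
      unfolding E_def oo_algebra_simps topspace_objects filters_at_neg [OF neg_closed [OF x]]
      by simp
  qed
  show "representation (\<^bold>\<rfloor> x) = \<^bold>\<rfloor>\<^bsub>E\<^esub> representation x" if x: "x \<in> carrier D"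
  proof -
    have "oo_diamond ?K (ideals_at D (\<^bold>\<rfloor> x)) = filters_at D (\<^bold>\<not> (\<^bold>\<rfloor> x))"
      using x by (simp add: oo_diamond_ideals_at opp_closed opp_idem)
    then show ?thesis
      unfolding E_def oo_algebra_simps topspace_attributes ideals_at_opp [OF x] by simp
  qed
  show "representation \<top> = \<top>\<^bsub>E\<^esub>" "representation \<bottom> = \<bottom>\<^bsub>E\<^esub>"
    unfolding E_def oo_algebra_simps topspace_objects topspace_attributes
    by (simp_all add: neg_top filters_at_bot filters_at_neg_bot ideals_at_top ideals_at_bot)
qed

lemma representation_clopen: "x \<in> carrier D \<Longrightarrow> representation x \<in> clopen_pairs (primary_context D)"
  unfolding clopen_pairs_def using clopenin_objects clopenin_attributes neg_closed by blast

lemma representation_subset: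
  "fst (representation x) \<subseteq> topspace (objects (primary_context D))"
  "snd (representation x) \<subseteq> topspace (attributes (primary_context D))"
  unfolding topspace_objects topspace_attributes by (auto simp: filters_at_def ideals_at_def)

lemma representation_protoconcept:
  assumes "x \<in> carrier D"
  shows "representation x \<in> oo_protoconcepts (primary_context D)"
proof -
  \<comment> \<open>Diamond after box yields the left side, diamond of the ideal component the right
    side; \<open>meet_join_idem\<close> reconciles them.\<close>
  have "\<^bold>\<not> ((x \<sqinter> x) \<squnion> (x \<sqinter> x)) = \<^bold>\<not> (x \<squnion> x)"
    using assms by (simp add: meet_join_idem join_closed neg_meet_idem)
  then have "oo_diamond (primary_context D) (oo_box (primary_context D) (filters_at D (\<^bold>\<not> x)))
      = oo_diamond (primary_context D) (ideals_at D x)"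
    using assms by (simp add: oo_box_filters_at oo_diamond_ideals_at meet_closed)
  then show ?thesis
    using representation_subset [of x] by (simp add: oo_protoconcepts_def)
qed

lemma representation_semiconcept:
  assumes "x \<in> carrier (pure_part D)"
  shows "representation x \<in> oo_semiconcepts (primary_context D)"
  using assms representation_subset [of x] oo_box_filters_at [of x] oo_diamond_ideals_at [of x]
  by (auto simp: pure_part_def oo_semiconcepts_def)

text \<open>Negation complements, so the first inclusion is the meet half of \<sqsubseteq>; the
  second is the join half, read in the dual.\<close>

lemma representation_le_iff:
  assumes "x \<in> carrier D" "y \<in> carrier D"
  shows "filters_at D (\<^bold>\<not> y) \<subseteq> filters_at D (\<^bold>\<not> x) \<and> ideals_at D y \<subseteq> ideals_at D x
    \<longleftrightarrow> x \<sqsubseteq> y"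
proof -
  have "filters_at D (\<^bold>\<not> y) \<subseteq> filters_at D (\<^bold>\<not> x) \<longleftrightarrow> filters_at D x \<subseteq> filters_at D y"
    using assms filters_at_subset [of x] by (auto simp: filters_at_neg)
  then show ?thesis
    unfolding dba_le_def using assms
    by (auto simp: filters_at_subset_iff ideals_at_subset_iff join_comm)
qed

text \<open>In \<open>oo_algebra\<close> the order on these pairs is reverse inclusion in both
  components.\<close>

lemma representation_reflects_le:
  assumes "x \<in> carrier D" "y \<in> carrier D"
  shows "x \<sqsubseteq> y \<longleftrightarrow> representation x \<sqsubseteq>\<^bsub>oo_algebra (primary_context D) P\<^esub> representation y"
  unfolding dba_le_def [of "oo_algebra (primary_context D) P"]
    representation_le_iff [OF assms, symmetric] oo_algebra_simps
  by (auto simp: Un_absorb2 Int_absorb1)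

lemma representation_eqD:
  assumes "x \<in> carrier D" "y \<in> carrier D" "representation x = representation y"
  shows "x \<sqsubseteq> y" "y \<sqsubseteq> x"
  using assms representation_le_iff by auto

section \<open>The pure part and the clopen semiconcepts\<close>

lemma pure_part_simps:
  "x \<squnion>\<^bsub>pure_part D\<^esub> y = x \<squnion> y" "x \<sqinter>\<^bsub>pure_part D\<^esub> y = x \<sqinter> y"
  "\<^bold>\<not>\<^bsub>pure_part D\<^esub> x = \<^bold>\<not> x" "\<^bold>\<rfloor>\<^bsub>pure_part D\<^esub> x = \<^bold>\<rfloor> x"
  "\<top>\<^bsub>pure_part D\<^esub> = \<top>" "\<bottom>\<^bsub>pure_part D\<^esub> = \<bottom>"
  by (simp_all add: pure_part_def)

lemma carrier_pure_part:
  "carrier (pure_part D) = {x \<in> carrier D. x \<sqinter> x = x \<or> x \<squnion> x = x}"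
  by (auto simp: pure_part_def)

lemma vee_pure_part: "x \<curlyvee>\<^bsub>pure_part D\<^esub> y = x \<curlyvee> y"
  by (simp add: vee_def pure_part_simps)

lemma wedge_pure_part: "x \<curlywedge>\<^bsub>pure_part D\<^esub> y = x \<curlywedge> y"
  by (simp add: wedge_def pure_part_simps)

lemma dba_pure_part: "dba (pure_part D)"
proof -
  \<comment> \<open>Arguments range over all of \<open>D\<close>: meets and negations are always
    \<sqinter>-idempotent, joins and oppositions always \<squnion>-idempotent.\<close>
  have closed: "x \<squnion> y \<in> carrier (pure_part D)" "x \<sqinter> y \<in> carrier (pure_part D)"
    "\<^bold>\<not> x \<in> carrier (pure_part D)" "\<^bold>\<rfloor> x \<in> carrier (pure_part D)"
    if "x \<in> carrier D" "y \<in> carrier D" for x y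
    using that unfolding carrier_pure_part
    by (auto simp: join_closed meet_closed neg_closed opp_closed join_join_idem meet_meet_idem
        neg_idem opp_idem)
  have sub: "x \<in> carrier D" if "x \<in> carrier (pure_part D)" for x
    using that by (simp add: carrier_pure_part)
  have bounds: "\<top> \<in> carrier (pure_part D)" "\<bottom> \<in> carrier (pure_part D)"
    using closed(4) [OF bot_closed bot_closed] closed(3) [OF top_closed top_closed]
    by (simp_all add: opp_bot neg_top)
  show ?thesis
    apply unfold_locales
    unfolding pure_part_simps vee_pure_part wedge_pure_part
    by (rule closed bounds
        meet_idem_left join_idem_left meet_comm join_comm meet_assoc join_assoc
        neg_meet_idem opp_join_idem meet_join_absorb join_meet_absorb
        meet_vee_distrib join_wedge_distrib meet_vee_absorb join_wedge_absorb
        neg_neg_meet opp_opp_join meet_neg join_opp neg_bot opp_top neg_top opp_bot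
        meet_join_idem; erule sub)+
qed

text \<open>Comparable in both directions forces \<open>x \<sqinter> x = y \<sqinter> y\<close> and \<open>x \<squnion> x = y \<squnion> y\<close>; in the mixed case
  the axiom \<open>(x \<sqinter> x) \<squnion> (x \<sqinter> x) = (x \<squnion> x) \<sqinter> (x \<squnion> x)\<close> then identifies the two.\<close>

lemma pure_part_antisym:
  assumes "x \<in> carrier (pure_part D)" "y \<in> carrier (pure_part D)" "x \<sqsubseteq> y" "y \<sqsubseteq> x"
  shows "x = y"
proof -
  have c: "x \<in> carrier D" "y \<in> carrier D" using assms by (simp_all add: carrier_pure_part)
  have "x \<sqinter> x = y \<sqinter> y" "x \<squnion> x = y \<squnion> y"
    using assms c unfolding dba_le_def by (metis meet_comm, metis join_comm)
  then show ?thesis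
    using assms c meet_join_idem [of x] meet_join_idem [of y] unfolding carrier_pure_part by auto
qed

text \<open>One component determines a semiconcept. If box of \<open>A\<close> is \<open>B\<close>,
  the preimage is \<not>\<open>a\<close>, where \<open>a\<close> represents \<open>A\<close>; if
  diamond of \<open>B\<close> is \<open>A\<close>, it is \<open>b \<squnion> b\<close>, where
  \<open>b\<close> represents \<open>B\<close>.\<close>

lemma representation_surj:
  assumes "p \<in> oo_semiconcepts (primary_context D) \<inter> clopen_pairs (primary_context D)"
  shows "p \<in> representation ` carrier (pure_part D)"
proof -
  obtain A B where p: "p = (A, B)" by fastforce
  obtain a b where ab: "a \<in> carrier D" "A = filters_at D a" "b \<in> carrier D" "B = ideals_at D b"
    using assms p by (auto simp: clopen_pairs_def clopenin_objects clopenin_attributes)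
  have A: "A = filters_at D (\<^bold>\<not> (\<^bold>\<not> a))" using ab by (simp add: filters_at_neg_neg)
  consider "oo_box (primary_context D) A = B" | "oo_diamond (primary_context D) B = A"
    using assms p by (auto simp: oo_semiconcepts_def)
  then show ?thesis
  proof cases
    case 1
    then have "p = representation (\<^bold>\<not> a)"
      using p A oo_box_filters_at [OF neg_closed [OF ab(1)]] neg_idem [OF ab(1)] by simp
    then show ?thesis
      using ab by (auto simp: carrier_pure_part neg_closed neg_idem)
  next
    case 2
    then have "p = representation (b \<squnion> b)"
      using p ab by (simp add: oo_diamond_ideals_at ideals_at_join)
    then show ?thesis
      using ab by (auto simp: carrier_pure_part join_closed join_join_idem)
  qed
qed

section \<open>Assembling the embeddings and the isomorphism\<close>

lemma dba_hom_protoconcepts: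
  "dba_hom D (clopen_protoconcept_algebra (primary_context D)) representation"
  unfolding dba_hom_def clopen_protoconcept_algebra_def
  using dba_axioms dba_clopen_algebra [OF oo_semiconcepts_subset order_refl] representation_hom
    representation_clopen representation_protoconcept
  by auto

lemma dba_hom_semiconcepts:
  "dba_hom (pure_part D) (clopen_semiconcept_algebra (primary_context D)) representation"
proof -
  have "x \<in> carrier D" if "x \<in> carrier (pure_part D)" for x
    using that by (simp add: carrier_pure_part)
  then show ?thesis
    unfolding dba_hom_def clopen_semiconcept_algebra_def pure_part_simps
    using dba_pure_part dba_clopen_algebra [OF order_refl oo_semiconcepts_subset] representation_hom
      representation_clopen representation_semiconcept
    by auto
qed

lemma bij_betw_semiconcepts:
  "bij_betw representation (carrier (pure_part D))
    (carrier (clopen_semiconcept_algebra (primary_context D)))"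
  unfolding bij_betw_def
proof
  have sub: "x \<in> carrier D" if "x \<in> carrier (pure_part D)" for x
    using that by (simp add: carrier_pure_part)
  show "inj_on representation (carrier (pure_part D))"
    using pure_part_antisym representation_eqD sub by (meson inj_onI)
  show "representation ` carrier (pure_part D)
      = carrier (clopen_semiconcept_algebra (primary_context D))"
    using representation_surj representation_semiconcept representation_clopen sub
    unfolding clopen_semiconcept_algebra_def oo_algebra_simps by blast
qed

end

theorem mainTheorem1:
  fixes D :: "('a, 'b) dba_scheme"
  assumes "dba D"
  shows "quasi_embedding D (clopen_protoconcept_algebra (primary_context D))
           (\<lambda>x. (filters_at D (\<^bold>\<not>\<^bsub>D\<^esub> x), ideals_at D x))
       \<and> dba_isomorphic (pure_part D) (clopen_semiconcept_algebra (primary_context D))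
       \<and> (contextual D \<longrightarrow>
            dba_embedding D (clopen_protoconcept_algebra (primary_context D))
              (\<lambda>x. (filters_at D (\<^bold>\<not>\<^bsub>D\<^esub> x), ideals_at D x)))"
proof (intro conjI impI)
  interpret dba D by fact
  show "quasi_embedding D (clopen_protoconcept_algebra (primary_context D)) representation"
    unfolding quasi_embedding_def
    using dba_hom_protoconcepts representation_reflects_le
    unfolding clopen_protoconcept_algebra_def by blast
  show "dba_isomorphic (pure_part D) (clopen_semiconcept_algebra (primary_context D))"
    unfolding dba_isomorphic_def using dba_hom_semiconcepts bij_betw_semiconcepts by blast
  assume "contextual D"
  then have "antisym {(x, y) \<in> carrier D \<times> carrier D. x \<sqsubseteq>\<^bsub>D\<^esub> y}"
    unfolding contextual_def partial_order_on_def by blast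
  then have "inj_on representation (carrier D)"
    using representation_eqD by (intro inj_onI) (auto dest: antisymD)
  then show "dba_embedding D (clopen_protoconcept_algebra (primary_context D)) representation"
    unfolding dba_embedding_def using dba_hom_protoconcepts by blast
qed

end
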